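(* Let $n\ge 1$ and let $C$ be a uniquely completable partial Latin square of order $n$, completing to the Latin square $L$. If $|C| > n^2-3n+3$, then $C$ is not a critical set.
   Context: Let $N$ be a set of $n$ symbols (also used to index rows and columns). A partial Latin square of order $n$ is an $n\times n$ array in which each cell is empty or contains one symbol of $N$, and each symbol occurs at most once in each row and at most once in each column; it is identified with the set of ordered triples (entries) $(i,j;k)$ meaning that symbol $k$ occurs in row $i$, column $j$. Its size $|C|$ is the number of its entries. A Latin square of order $n$ is a partial Latin square of order $n$ with $n^2$ entries. A partial Latin square $C$ is uniquely completable if it is a subset of exactly one Latin square $L$ of order $n$ (on the symbol set $N$); one says that $C$ completes to $L$. A critical set of a Latin square $L$ is a proper subset $C\subset L$ which is uniquely completable (to $L$) and such that the omission of any entry of $C$ destroys the unique completion property, i.e. for every $t\in C$, the set $C\setminus\{t\}$ is contained in more than one Latin square of order $n$. *)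

theory Defs
  imports Main
begin

(* The finite set N serves as row indices, column indices and symbols;
   the triple (i, j, k) is the entry "symbol k in row i, column j". *)

definition partial_latin_square :: "'a set \<Rightarrow> ('a \<times> 'a \<times> 'a) set \<Rightarrow> bool" where
  "partial_latin_square N P \<longleftrightarrow>
     P \<subseteq> N \<times> N \<times> N \<and>
     (\<forall>i j k k'. (i, j, k) \<in> P \<and> (i, j, k') \<in> P \<longrightarrow> k = k') \<and>
     (\<forall>i j j' k. (i, j, k) \<in> P \<and> (i, j', k) \<in> P \<longrightarrow> j = j') \<and>
     (\<forall>i i' j k. (i, j, k) \<in> P \<and> (i', j, k) \<in> P \<longrightarrow> i = i')"

definition latin_square :: "'a set \<Rightarrow> ('a \<times> 'a \<times> 'a) set \<Rightarrow> bool" where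
  "latin_square N L \<longleftrightarrow> partial_latin_square N L \<and> card L = (card N)\<^sup>2"

definition uniquely_completable :: "'a set \<Rightarrow> ('a \<times> 'a \<times> 'a) set \<Rightarrow> bool" where
  "uniquely_completable N C \<longleftrightarrow>
     partial_latin_square N C \<and> (\<exists>!L. latin_square N L \<and> C \<subseteq> L)"

definition completes_to ::
  "'a set \<Rightarrow> ('a \<times> 'a \<times> 'a) set \<Rightarrow> ('a \<times> 'a \<times> 'a) set \<Rightarrow> bool" where
  "completes_to N C L \<longleftrightarrow> uniquely_completable N C \<and> latin_square N L \<and> C \<subseteq> L"

definition critical_set ::
  "'a set \<Rightarrow> ('a \<times> 'a \<times> 'a) set \<Rightarrow> ('a \<times> 'a \<times> 'a) set \<Rightarrow> bool" where
  "critical_set N L C \<longleftrightarrow>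
     C \<subset> L \<and> completes_to N C L \<and>
     (\<forall>t\<in>C. \<exists>L1 L2. L1 \<noteq> L2 \<and>
        latin_square N L1 \<and> C - {t} \<subseteq> L1 \<and>
        latin_square N L2 \<and> C - {t} \<subseteq> L2)"

end

theory Submission
  imports Defs
begin

text \<open>Let \<open>E\<close> be the set of cells left empty by a critical set; we need \<open>|E| \<ge> 3n - 3\<close>. Deleting a
  filled cell \<open>t\<close> admits a Latin square \<open>h\<close> that differs from \<open>L\<close> in \<open>t\<close> and otherwise only inside
  \<open>E\<close>. Comparing \<open>h\<close> with \<open>L\<close> in the row of \<open>t\<close> shows that every row meets \<open>E\<close>, that a row
  with a single cell of \<open>E\<close> forces a column contained in \<open>E\<close> and a symbol whose cells all lie in \<open>E\<close>
  (whence the bound), and that if a row meets \<open>E\<close> in just two cells then the two columns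
  concerned together miss every symbol, so they contain at least \<open>n\<close> cells of \<open>E\<close>. As all other
  columns may be assumed to contain at least two, \<open>|E| \<ge> 3n - 4\<close>. In the case of
  equality the two columns miss disjoint sets of symbols and all other columns contain exactly two cells
  of \<open>E\<close>. Call a line large if it has more than two cells of \<open>E\<close>. Disjointness excludes
  that all lines have exactly two, so there are a large row and a large column. Every two-cell column then meets
  the large row in \<open>E\<close>, which makes all other rows two-cell rows; each of these \<open>n - 1\<close> rows meets
  the large column in \<open>E\<close>, although that column contains at most \<open>n - 2\<close> cells of \<open>E\<close>.\<close>

section \<open>Latin squares as two-variable functions\<close>

text \<open>Storing the square as an array makes transposition a swap of arguments, so every row
  statement yields its column version. Values outside \<open>N\<close> are unconstrained.\<close>

definition latin_fun :: "'a set \<Rightarrow> ('a \<Rightarrow> 'a \<Rightarrow> 'a) \<Rightarrow> bool" where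
  "latin_fun N g \<longleftrightarrow>
     (\<forall>i\<in>N. bij_betw (g i) N N) \<and> (\<forall>j\<in>N. bij_betw (\<lambda>i. g i j) N N)"

lemma latin_fun_transpose: "latin_fun N g \<Longrightarrow> latin_fun N (\<lambda>i j. g j i)"
  by (simp add: latin_fun_def)

lemma latin_fun_closed: "latin_fun N g \<Longrightarrow> i \<in> N \<Longrightarrow> j \<in> N \<Longrightarrow> g i j \<in> N"
  by (auto simp: latin_fun_def bij_betw_def)

lemma latin_fun_row_inj:
  "latin_fun N g \<Longrightarrow> i \<in> N \<Longrightarrow> j \<in> N \<Longrightarrow> j' \<in> N \<Longrightarrow> g i j = g i j' \<longleftrightarrow> j = j'"
  by (auto simp: latin_fun_def bij_betw_def inj_on_def)

lemma latin_fun_col_inj: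
  "latin_fun N g \<Longrightarrow> i \<in> N \<Longrightarrow> i' \<in> N \<Longrightarrow> j \<in> N \<Longrightarrow> g i j = g i' j \<longleftrightarrow> i = i'"
  by (rule latin_fun_row_inj[OF latin_fun_transpose])

lemma latin_fun_row_surj:
  assumes "latin_fun N g" "i \<in> N" "k \<in> N"
  obtains j where "j \<in> N" "g i j = k"
proof -
  have "k \<in> g i ` N" using assms by (simp add: latin_fun_def bij_betw_def)
  then show thesis using that by auto
qed

lemma latin_fun_col_surj:
  assumes "latin_fun N g" "j \<in> N" "k \<in> N"
  obtains i where "i \<in> N" "g i j = k"
  using latin_fun_row_surj[OF latin_fun_transpose[OF assms(1)] assms(2,3)] .

lemma latin_square_obtain_fun:
  assumes "finite N" "latin_square N L"
  obtains g where "latin_fun N g" "L = {(i, j, g i j) | i j. i \<in> N \<and> j \<in> N}"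
proof -
  have P: "partial_latin_square N L" and cL: "card L = (card N)\<^sup>2"
    using assms(2) by (auto simp: latin_square_def)
  have sub: "L \<subseteq> N \<times> N \<times> N"
    and cell: "\<And>i j k k'. (i, j, k) \<in> L \<Longrightarrow> (i, j, k') \<in> L \<Longrightarrow> k = k'"
    and row: "\<And>i j j' k. (i, j, k) \<in> L \<Longrightarrow> (i, j', k) \<in> L \<Longrightarrow> j = j'"
    and col: "\<And>i i' j k. (i, j, k) \<in> L \<Longrightarrow> (i', j, k) \<in> L \<Longrightarrow> i = i'"
    using P unfolding partial_latin_square_def by blast+
  define f :: "'a \<times> 'a \<times> 'a \<Rightarrow> 'a \<times> 'a" where "f = (\<lambda>(i, j, k). (i, j))"
  have "inj_on f L" using cell by (auto simp: inj_on_def f_def)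
  then have "card (f ` L) = card (N \<times> N)"
    using cL by (simp add: card_image card_cartesian_product power2_eq_square)
  moreover have "f ` L \<subseteq> N \<times> N" using sub by (auto simp: f_def)
  ultimately have fL: "f ` L = N \<times> N" using assms(1) by (simp add: card_subset_eq)
  define g where "g = (\<lambda>i j. THE k. (i, j, k) \<in> L)"
  have g: "(i, j, g i j) \<in> L" if "i \<in> N" "j \<in> N" for i j
  proof -
    have "(i, j) \<in> f ` L" using fL that by simp
    then obtain k where k: "(i, j, k) \<in> L" by (auto simp: f_def)
    then show ?thesis unfolding g_def by (rule theI) (rule cell[OF _ k])
  qed
  have L: "L = {(i, j, g i j) | i j. i \<in> N \<and> j \<in> N}"
  proof (intro equalityI subsetI)
    fix t assume t: "t \<in> L"
    then obtain i j k where ijk: "t = (i, j, k)" "i \<in> N" "j \<in> N" using sub by auto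
    then have "k = g i j" using cell[OF _ g] t by blast
    then show "t \<in> {(i, j, g i j) | i j. i \<in> N \<and> j \<in> N}" using ijk by blast
  qed (use g in blast)
  have gN: "g i j \<in> N" if "i \<in> N" "j \<in> N" for i j using g[OF that] sub by auto
  have "bij_betw (g i) N N" if i: "i \<in> N" for i
  proof -
    have "p = q" if "p \<in> N" "q \<in> N" "g i p = g i q" for p q
      using row g[OF i that(1)] g[OF i that(2)] that(3) by simp
    then have "inj_on (g i) N" by (rule inj_onI)
    moreover have "g i ` N \<subseteq> N" using gN i by auto
    ultimately show ?thesis using assms(1) by (simp add: bij_betw_def endo_inj_surj)
  qed
  moreover have "bij_betw (\<lambda>i. g i j) N N" if j: "j \<in> N" for j
  proof -
    have "p = q" if "p \<in> N" "q \<in> N" "g p j = g q j" for p q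
      using col g[OF that(1) j] g[OF that(2) j] that(3) by simp
    then have "inj_on (\<lambda>i. g i j) N" by (rule inj_onI)
    moreover have "(\<lambda>i. g i j) ` N \<subseteq> N" using gN j by auto
    ultimately show ?thesis using assms(1) by (simp add: bij_betw_def endo_inj_surj)
  qed
  ultimately have "latin_fun N g" by (simp add: latin_fun_def)
  then show ?thesis using that L by blast
qed

lemma card_2_obtain:
  assumes "card A = 2" "x \<in> A"
  obtains y where "A = {x, y}" "x \<noteq> y"
proof -
  obtain u v where "A = {u, v}" "u \<noteq> v" using assms(1) by (auto simp: card_2_iff)
  then show thesis using assms(2) that[of u] that[of v] by auto
qed

section \<open>Sets of cells that meet every trade as criticality demands\<close>

text \<open>\<open>E\<close> stands for the empty cells and \<open>g\<close> for the completed
  square. Of criticality only \<open>trade\<close> is kept: each filled cell can be changed by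
  altering, apart from it, only cells of \<open>E\<close>.\<close>

locale trade_cover =
  fixes N :: "'a set" and g :: "'a \<Rightarrow> 'a \<Rightarrow> 'a" and E :: "('a \<times> 'a) set"
  assumes fin: "finite N" and nonempty: "N \<noteq> {}"
    and latin: "latin_fun N g"
    and E_sub: "E \<subseteq> N \<times> N"
    and trade: "i \<in> N \<Longrightarrow> j \<in> N \<Longrightarrow> (i, j) \<notin> E \<Longrightarrow>
      \<exists>h. latin_fun N h \<and> h i j \<noteq> g i j \<and>
        (\<forall>p\<in>N. \<forall>q\<in>N. (p, q) \<notin> E \<longrightarrow> (p, q) \<noteq> (i, j) \<longrightarrow> h p q = g p q)"
begin

lemma transpose: "trade_cover N (\<lambda>i j. g j i) (E\<inverse>)"
proof
  show "finite N" "N \<noteq> {}" by (fact fin nonempty)+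
  show "latin_fun N (\<lambda>i j. g j i)" using latin by (rule latin_fun_transpose)
  show "E\<inverse> \<subseteq> N \<times> N" using E_sub by auto
next
  fix i j assume "i \<in> N" "j \<in> N" "(i, j) \<notin> E\<inverse>"
  then obtain h where "latin_fun N h" "h j i \<noteq> g j i"
    "\<forall>p\<in>N. \<forall>q\<in>N. (p, q) \<notin> E \<longrightarrow> (p, q) \<noteq> (j, i) \<longrightarrow> h p q = g p q"
    using trade[of j i] by auto
  then show "\<exists>h. latin_fun N h \<and> h i j \<noteq> g j i \<and>
      (\<forall>p\<in>N. \<forall>q\<in>N. (p, q) \<notin> E\<inverse> \<longrightarrow> (p, q) \<noteq> (i, j) \<longrightarrow> h p q = g q p)"
    by (intro exI[of _ "\<lambda>i j. h j i"]) (auto intro: latin_fun_transpose)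
qed

abbreviation rowE :: "'a \<Rightarrow> 'a set" where "rowE i \<equiv> E `` {i}"
abbreviation colE :: "'a \<Rightarrow> 'a set" where "colE j \<equiv> E\<inverse> `` {j}"

text \<open>The symbols that the partial square lacks in column \<open>j\<close>, read off from the
  cells of \<open>E\<close> there.\<close>

definition missing :: "'a \<Rightarrow> 'a set" where
  "missing j = (\<lambda>p. g p j) ` colE j"

lemma rowE_sub: "rowE i \<subseteq> N" and colE_sub: "colE j \<subseteq> N"
  using E_sub by auto

lemma finite_rowE: "finite (rowE i)" and finite_colE: "finite (colE j)"
  by (rule finite_subset[OF rowE_sub fin] finite_subset[OF colE_sub fin])+

lemma finite_missing: "finite (missing j)"
  by (simp add: missing_def finite_colE)

lemma missing_sub: "j \<in> N \<Longrightarrow> missing j \<subseteq> N"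
  using colE_sub latin by (auto simp: missing_def intro: latin_fun_closed)

lemma missingI: "(i, j) \<in> E \<Longrightarrow> g i j \<in> missing j"
  by (auto simp: missing_def)

lemma missingD:
  assumes "g i j \<in> missing j" "i \<in> N" "j \<in> N"
  shows "(i, j) \<in> E"
proof -
  obtain p where "(p, j) \<in> E" "g p j = g i j"
    using assms(1) by (auto simp: missing_def)
  moreover have "p \<in> N" using \<open>(p, j) \<in> E\<close> E_sub by auto
  ultimately show ?thesis
    using latin_fun_col_inj[OF latin, of p i j] assms by auto
qed

lemma card_missing: "j \<in> N \<Longrightarrow> card (missing j) = card (colE j)"
  unfolding missing_def
  by (rule card_image, rule inj_onI)
    (use colE_sub[of j] latin_fun_col_inj[OF latin] in blast)

lemma card_E_rows: "card E = (\<Sum>i\<in>N. card (rowE i))"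
proof -
  have "E = (SIGMA i:N. rowE i)" using E_sub by auto
  then show ?thesis
    using card_SigmaI[OF fin, of rowE] finite_rowE by auto
qed

lemma card_E_cols: "card E = (\<Sum>j\<in>N. card (colE j))"
  using trade_cover.card_E_rows[OF transpose] by simp

text \<open>Only \<open>(i, j)\<close> and cells of \<open>E\<close> can change. Hence a symbol new
  to a cell of row \<open>i\<close> has left a cell of \<open>E\<close> in that column, while within
  the row the new symbol of \<open>(i, j)\<close> comes from a cell of \<open>E\<close> and the old
  one moves to such a cell.\<close>

lemma row_trade:
  assumes "i \<in> N" "j \<in> N" "(i, j) \<notin> E"
  obtains h where "latin_fun N h" "h i j \<noteq> g i j"
    "\<And>p q. p \<in> N \<Longrightarrow> q \<in> N \<Longrightarrow> (p, q) \<notin> E \<Longrightarrow> (p, q) \<noteq> (i, j) \<Longrightarrow> h p q = g p q"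
    "\<And>q. q \<in> N \<Longrightarrow> h i q \<noteq> g i q \<Longrightarrow> h i q \<in> missing q"
    "h i j \<in> g i ` rowE i" "\<exists>q\<in>rowE i. h i q = g i j"
proof -
  obtain h where h: "latin_fun N h" "h i j \<noteq> g i j"
    and same: "\<And>p q. p \<in> N \<Longrightarrow> q \<in> N \<Longrightarrow> (p, q) \<notin> E \<Longrightarrow> (p, q) \<noteq> (i, j) \<Longrightarrow> h p q = g p q"
    using trade[OF assms] by auto
  have miss: "h i q \<in> missing q" if q: "q \<in> N" "h i q \<noteq> g i q" for q
  proof -
    obtain p where p: "p \<in> N" "g p q = h i q"
      using latin_fun_col_surj[OF latin] latin_fun_closed[OF h(1)] assms(1) q(1) by metis
    have "p \<noteq> i" using p q by auto
    \<comment> \<open>Otherwise \<open>h\<close> would keep this symbol at \<open>(p, q)\<close> and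
      repeat it in column \<open>q\<close>.\<close>
    then have "(p, q) \<in> E"
      using same[of p q] p q latin_fun_col_inj[OF h(1), of p i q] assms(1) by auto
    then show ?thesis using p missingI by metis
  qed
  have "h i j \<in> g i ` rowE i"
  proof -
    obtain q where q: "q \<in> N" "g i q = h i j"
      using latin_fun_row_surj[OF latin] latin_fun_closed[OF h(1)] assms by metis
    then have "q \<noteq> j" using h by auto
    then have "(i, q) \<in> E"
      using same[of i q] q latin_fun_row_inj[OF h(1), of i q j] assms by auto
    then show ?thesis using q by (metis ImageI image_eqI singletonI)
  qed
  moreover have "\<exists>q\<in>rowE i. h i q = g i j"
  proof -
    obtain q where q: "q \<in> N" "h i q = g i j"
      using latin_fun_row_surj[OF h(1)] latin_fun_closed[OF latin] assms by metis
    then have "q \<noteq> j" using h by auto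
    then have "(i, q) \<in> E"
      using same[of i q] q latin_fun_row_inj[OF latin, of i q j] assms by auto
    then show ?thesis using q by auto
  qed
  ultimately show thesis using that h same miss by blast
qed

lemma ex_pair_row:
  assumes "\<And>i. i \<in> N \<Longrightarrow> card (rowE i) \<ge> 2" "card E < 3 * card N"
  shows "\<exists>i\<in>N. card (rowE i) = 2"
proof (rule ccontr)
  assume "\<not> ?thesis"
  then have "card (rowE i) \<ge> 3" if "i \<in> N" for i
    using assms(1)[OF that] that by (metis antisym not_less_eq_eq numeral_2_eq_2 numeral_3_eq_3)
  then have "(\<Sum>i\<in>N. card (rowE i)) \<ge> (\<Sum>i\<in>N. 3)" by (intro sum_mono) auto
  then show False using assms(2) card_E_rows by simp
qed

section \<open>Rows with at most two cells of \<open>E\<close>\<close>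

lemma row_nonempty:
  assumes "i \<in> N"
  shows "card (rowE i) \<ge> 1"
proof (rule ccontr)
  assume "\<not> card (rowE i) \<ge> 1"
  then have "rowE i = {}" using finite_rowE by (simp add: not_le)
  moreover obtain j where "j \<in> N" using nonempty by auto
  moreover from calculation have "(i, j) \<notin> E" by auto
  ultimately show False using row_trade[of i j] assms by (metis empty_iff)
qed

text \<open>A trade at \<open>(i, j)\<close> must exchange the symbols of \<open>(i, j)\<close> and
  \<open>(i, j0)\<close>, so each symbol is missing from the column of the other. Letting
  \<open>j\<close> vary, column \<open>j0\<close> misses every symbol and the symbol
  \<open>g i j0\<close> is missing everywhere.\<close>

lemma singleton_row:
  assumes i: "i \<in> N" and R: "rowE i = {j0}"
  shows "colE j0 = N" and "j \<in> N \<Longrightarrow> g i j0 \<in> missing j"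
proof -
  have j0: "j0 \<in> N" "(i, j0) \<in> E" using rowE_sub[of i] R by auto
  have both: "g i j \<in> missing j0 \<and> g i j0 \<in> missing j" if j: "j \<in> N" for j
  proof (cases "j = j0")
    case True
    then show ?thesis using j0 missingI by auto
  next
    case False
    then have "(i, j) \<notin> E" using R by auto
    then obtain h where h: "latin_fun N h" "h i j \<noteq> g i j"
      and miss: "\<And>q. q \<in> N \<Longrightarrow> h i q \<noteq> g i q \<Longrightarrow> h i q \<in> missing q"
      and sw: "h i j \<in> g i ` rowE i" "\<exists>q\<in>rowE i. h i q = g i j"
      using row_trade[OF i j] by metis
    then have "h i j = g i j0" "h i j0 = g i j" using R by auto
    then show ?thesis using miss[of j] miss[of j0] h(2) j j0 by metis
  qed
  show "j \<in> N \<Longrightarrow> g i j0 \<in> missing j" using both by blast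
  have "p \<in> colE j0" if p: "p \<in> N" for p
  proof -
    obtain j where "j \<in> N" "g i j = g p j0"
      using latin_fun_row_surj[OF latin i] latin_fun_closed[OF latin p j0(1)] by metis
    then have "g p j0 \<in> missing j0" using both by metis
    then show ?thesis using missingD p j0 by auto
  qed
  then show "colE j0 = N" using colE_sub by blast
qed

lemma card_E_ge_if_singleton_row:
  assumes i: "i \<in> N" and c1: "card (rowE i) = 1"
  shows "card E + 3 \<ge> 3 * card N"
proof -
  obtain j0 where R: "rowE i = {j0}" using c1 by (auto simp: card_1_singleton_iff)
  have j0: "j0 \<in> N" using rowE_sub R by auto
  note sr = singleton_row[OF i R]
  \<comment> \<open>Two distinct cells of row \<open>p\<close> lie in \<open>E\<close>: the one in
    column \<open>j0\<close> and the one holding \<open>g i j0\<close>.\<close>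
  have row2: "card (rowE p) \<ge> 2" if p: "p \<in> N" "p \<noteq> i" for p
  proof -
    obtain q where q: "q \<in> N" "g p q = g i j0"
      using latin_fun_row_surj[OF latin p(1)] latin_fun_closed[OF latin i j0] by metis
    have "q \<noteq> j0" using q p i j0 latin_fun_col_inj[OF latin, of p i j0] by auto
    moreover have "q \<in> rowE p" using sr(2)[OF q(1)] q p missingD by auto
    moreover have "j0 \<in> rowE p" using sr(1) p by auto
    ultimately show ?thesis
      using card_mono[OF finite_rowE, of "{j0, q}" p] by simp
  qed
  show ?thesis
  proof (cases "\<forall>j\<in>N - {j0}. card (colE j) \<ge> 2")
    case True
    \<comment> \<open>Here the count is at least \<open>n + 2(n - 1)\<close>.\<close>
    have "card E = card (colE j0) + (\<Sum>j\<in>N - {j0}. card (colE j))"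
      unfolding card_E_cols by (rule sum.remove[OF fin j0])
    moreover have "(\<Sum>j\<in>N - {j0}. card (colE j)) \<ge> (\<Sum>j\<in>N - {j0}. 2)"
      by (rule sum_mono) (use True in auto)
    ultimately show ?thesis using sr(1) j0 by (simp add: card_Diff_singleton)
  next
    case False
    then obtain j where "j \<in> N - {j0}" "\<not> card (colE j) \<ge> 2" by blast
    then have j: "j \<in> N" "j \<noteq> j0" "card (colE j) < 2" by auto
    have "card (colE j) = 1"
      using trade_cover.row_nonempty[OF transpose j(1)] j(3) by simp
    then obtain p where p: "colE j = {p}" by (auto simp: card_1_singleton_iff)
    \<comment> \<open>The transposed singleton argument makes row \<open>p\<close> full, and
      counting by rows gives at least \<open>1 + n + 2(n - 2)\<close>, exactly the required
      bound.\<close>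
    have full: "rowE p = N"
      using trade_cover.singleton_row(1)[OF transpose j(1) p] by simp
    have pN: "p \<in> N" using colE_sub p by auto
    have pi: "p \<noteq> i" using p R j by auto
    have "card E = card (rowE i) + (card (rowE p) + (\<Sum>q\<in>N - {i} - {p}. card (rowE q)))"
      unfolding card_E_rows
      using sum.remove[OF fin i, of "\<lambda>q. card (rowE q)"]
        sum.remove[of "N - {i}" p "\<lambda>q. card (rowE q)"] fin pN pi by simp
    moreover have "(\<Sum>q\<in>N - {i} - {p}. card (rowE q)) \<ge> (\<Sum>q\<in>N - {i} - {p}. 2)"
      by (rule sum_mono) (use row2 in auto)
    ultimately show ?thesis using full c1 i pN pi by (simp add: card_Diff_singleton)
  qed
qed

text \<open>A symbol at a cell of row \<open>i\<close> outside \<open>E\<close> can be traded away;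
  it then moves within the row to column \<open>j0\<close> or \<open>j1\<close>, where it must be
  missing.\<close>

lemma pair_row_missing:
  assumes i: "i \<in> N" and R: "rowE i = {j0, j1}"
  shows "missing j0 \<union> missing j1 = N"
proof -
  have j: "j0 \<in> N" "j1 \<in> N" "(i, j0) \<in> E" "(i, j1) \<in> E" using rowE_sub[of i] R by auto
  have "k \<in> missing j0 \<union> missing j1" if k: "k \<in> N" for k
  proof -
    obtain j where j': "j \<in> N" "g i j = k" using latin_fun_row_surj[OF latin i k] .
    show ?thesis
    proof (cases "(i, j) \<in> E")
      case True
      then show ?thesis using R j' missingI[OF True] by auto
    next
      case False
      then obtain h where h: "latin_fun N h" "h i j \<noteq> g i j"
        and miss: "\<And>q. q \<in> N \<Longrightarrow> h i q \<noteq> g i q \<Longrightarrow> h i q \<in> missing q"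
        and sw: "\<exists>q\<in>rowE i. h i q = g i j"
        using row_trade[OF i j'(1)] by metis
      obtain q where q: "q \<in> rowE i" "h i q = k" using sw j' by auto
      have "q \<noteq> j" "q \<in> N" using False q rowE_sub by auto
      then have "g i q \<noteq> k" using j' i latin_fun_row_inj[OF latin, of i q j] by auto
      then have "k \<in> missing q" using miss[OF \<open>q \<in> N\<close>] q by auto
      then show ?thesis using q R by auto
    qed
  qed
  then show ?thesis using missing_sub j by blast
qed

lemma split_cols:
  assumes "j0 \<in> N" "j1 \<in> N" "j0 \<noteq> j1"
  shows "card E = card (colE j0) + card (colE j1) + (\<Sum>j\<in>N - {j0, j1}. card (colE j))"
  unfolding card_E_cols
  using sum.subset_diff[of "{j0, j1}" N "\<lambda>j. card (colE j)"] assms fin by simp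

text \<open>Columns \<open>j0\<close> and \<open>j1\<close> contribute at least \<open>n\<close> and
  the others two each, so at least \<open>n + 2(n - 2)\<close> in total; equality makes each of
  these estimates tight.\<close>

lemma card_E_ge_if_pair_row:
  assumes i: "i \<in> N" and R: "rowE i = {j0, j1}" "j0 \<noteq> j1"
    and col2: "\<And>j. j \<in> N \<Longrightarrow> card (colE j) \<ge> 2"
  shows "card E + 4 \<ge> 3 * card N"
    and "card E + 4 = 3 * card N \<Longrightarrow>
      card (colE j0) + card (colE j1) = card N \<and> missing j0 \<inter> missing j1 = {} \<and>
      (\<forall>j\<in>N - {j0, j1}. card (colE j) = 2)"
proof -
  have j: "j0 \<in> N" "j1 \<in> N" using rowE_sub[of i] R by auto
  have M: "card N + card (missing j0 \<inter> missing j1) = card (colE j0) + card (colE j1)"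
    using card_Un_Int[OF finite_missing finite_missing, of j0 j1] pair_row_missing[OF i R(1)]
      card_missing j by simp
  have "card {j0, j1} \<le> card N" using j fin by (intro card_mono) auto
  then have n2: "card N \<ge> 2" using R by simp
  have D: "(\<Sum>j\<in>N - {j0, j1}. 2) = 2 * card N - (4 :: nat)"
    using j R fin by (simp add: card_Diff_subset)
  have ge: "(\<Sum>j\<in>N - {j0, j1}. card (colE j)) \<ge> (\<Sum>j\<in>N - {j0, j1}. 2)"
    by (rule sum_mono) (use col2 in auto)
  note S = split_cols[OF j R(2)]
  show "card E + 4 \<ge> 3 * card N" using S M D ge n2 by linarith
  assume eq: "card E + 4 = 3 * card N"
  have "card (missing j0 \<inter> missing j1) = 0" using S M D ge n2 eq by linarith
  moreover have "(\<Sum>j\<in>N - {j0, j1}. card (colE j)) = (\<Sum>j\<in>N - {j0, j1}. 2)"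
    using S M D ge n2 eq by linarith
  then have "card (colE j) = 2" if "j \<in> N - {j0, j1}" for j
    using sum_mono_inv[of "\<lambda>_. 2" "N - {j0, j1}" "\<lambda>j. card (colE j)" j] that col2 fin
    by fastforce
  ultimately show "card (colE j0) + card (colE j1) = card N \<and> missing j0 \<inter> missing j1 = {} \<and>
      (\<forall>j\<in>N - {j0, j1}. card (colE j) = 2)"
    using M finite_missing by (simp add: card_eq_0_iff)
qed

end

section \<open>Excluding the value \<open>3n - 4\<close>\<close>

locale extremal_trade_cover = trade_cover +
  assumes row2: "i \<in> N \<Longrightarrow> card (rowE i) \<ge> 2"
    and col2: "j \<in> N \<Longrightarrow> card (colE j) \<ge> 2"
    and card_E: "card E + 4 = 3 * card N"
begin

lemma transpose_extremal: "extremal_trade_cover N (\<lambda>i j. g j i) (E\<inverse>)"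
  unfolding extremal_trade_cover_def extremal_trade_cover_axioms_def
  using transpose row2 col2 card_E by simp

lemma pair_row:
  assumes "i \<in> N" "rowE i = {j0, j1}" "j0 \<noteq> j1"
  shows "card (colE j0) + card (colE j1) = card N"
    and "missing j0 \<inter> missing j1 = {}"
    and "j \<in> N \<Longrightarrow> j \<noteq> j0 \<Longrightarrow> j \<noteq> j1 \<Longrightarrow> card (colE j) = 2"
  using card_E_ge_if_pair_row(2)[OF assms col2 card_E] by auto

text \<open>Trading the symbol \<open>k\<close> of cell \<open>(p, j0)\<close> away from its place
  in row \<open>i\<close> forces a chain of moves through column \<open>j0\<close> into row
  \<open>p\<close>, which breaks the disjointness of missing symbols there.\<close>

lemma pair_col_not_all_pair_rows:
  assumes j0: "j0 \<in> N" and C: "colE j0 = {i, p}" "i \<noteq> p"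
    and ri: "card (rowE i) = 2" and rp: "card (rowE p) = 2"
  shows False
proof -
  have E: "(i, j0) \<in> E" "(p, j0) \<in> E" and N: "i \<in> N" "p \<in> N" using C colE_sub[of j0] by auto
  obtain j1 where R: "rowE i = {j0, j1}" "j0 \<noteq> j1"
    using card_2_obtain[OF ri, of j0] E by auto
  have j1: "j1 \<in> N" "(i, j1) \<in> E" using R rowE_sub[of i] by auto
  define k where "k = g p j0"
  have k: "k \<in> missing j0" "k \<notin> missing j1" "k \<noteq> g i j0" "k \<in> N"
    using missingI[OF E(2)] pair_row(2)[OF N(1) R] latin_fun_col_inj[OF latin N j0] C
      latin_fun_closed[OF latin N(2) j0] by (auto simp: k_def)
  obtain j where j: "j \<in> N" "g i j = k" using latin_fun_row_surj[OF latin N(1) k(4)] .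
  have jn: "j \<noteq> j0" "j \<noteq> j1" using j k missingI[OF j1(2)] by auto
  then have "(i, j) \<notin> E" using R by auto
  then obtain h where h: "latin_fun N h"
    and same: "\<And>p q. p \<in> N \<Longrightarrow> q \<in> N \<Longrightarrow> (p, q) \<notin> E \<Longrightarrow> (p, q) \<noteq> (i, j) \<Longrightarrow> h p q = g p q"
    and miss: "\<And>q. q \<in> N \<Longrightarrow> h i q \<noteq> g i q \<Longrightarrow> h i q \<in> missing q"
    and sw: "\<exists>q\<in>rowE i. h i q = g i j"
    using row_trade[OF N(1) j(1)] by metis
  \<comment> \<open>By disjointness \<open>k\<close> is not missing from column \<open>j1\<close>,
    so it can only move to \<open>(i, j0)\<close>.\<close>
  have "h i j1 \<noteq> k"
    using miss[OF j1(1)] k j jn latin_fun_row_inj[OF latin N(1) j(1) j1(1)] by metis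
  then have hi: "h i j0 = k" using sw R j by auto
  obtain s where s: "s \<in> N" "h s j0 = g i j0"
    using latin_fun_col_surj[OF h j0] latin_fun_closed[OF latin N(1) j0] by metis
  have "s \<noteq> i" using s hi k by auto
  \<comment> \<open>The symbol displaced from \<open>(i, j0)\<close> must reappear in column
    \<open>j0\<close>, whose only other cell of \<open>E\<close> is in row \<open>p\<close>.\<close>
  have "s = p"
  proof (rule ccontr)
    assume "s \<noteq> p"
    then have "(s, j0) \<notin> E" using C \<open>s \<noteq> i\<close> by auto
    then have "h s j0 = g s j0" using same[OF s(1) j0] jn by auto
    then show False using s \<open>s \<noteq> i\<close> latin_fun_col_inj[OF latin s(1) N(1) j0] by auto
  qed
  obtain q where q: "q \<in> N" "g p q = g i j0"
    using latin_fun_row_surj[OF latin N(2)] latin_fun_closed[OF latin N(1) j0] by metis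
  have "q \<noteq> j0" using q k by (auto simp: k_def)
  \<comment> \<open>Otherwise \<open>h\<close> would have \<open>g i j0\<close> twice in row
    \<open>p\<close>, in columns \<open>q\<close> and \<open>j0\<close>.\<close>
  then have pq: "(p, q) \<in> E"
    using same[OF N(2) q(1)] C(2) q s \<open>s = p\<close> latin_fun_row_inj[OF h N(2) q(1) j0] by auto
  have "rowE p = {j0, q}" using card_2_obtain[OF rp, of j0] pq E(2) \<open>q \<noteq> j0\<close> by auto
  then have "missing j0 \<inter> missing q = {}" using pair_row(2)[OF N(2)] \<open>q \<noteq> j0\<close> by metis
  then show False using missingI[OF E(1)] missingI[OF pq] q by auto
qed

text \<open>If all columns have two cells, then \<open>E\<close> has \<open>2n\<close> cells and all
  rows have exactly two as well.\<close>

lemma ex_large_col: "\<exists>j\<in>N. card (colE j) > 2"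
proof (rule ccontr)
  assume *: "\<not> ?thesis"
  then have c: "\<And>j. j \<in> N \<Longrightarrow> card (colE j) = 2" using col2 by force
  then have n: "card E = 2 * card N" using card_E_cols by simp
  have "(\<Sum>i\<in>N. 2) = (\<Sum>i\<in>N. card (rowE i))" using n card_E_rows by simp
  then have r: "card (rowE i) = 2" if "i \<in> N" for i
    using sum_mono_inv[of "\<lambda>_. 2" N "\<lambda>i. card (rowE i)" i] that row2 fin by fastforce
  obtain j where j: "j \<in> N" using nonempty by auto
  then obtain i p where "colE j = {i, p}" "i \<noteq> p" using c[OF j] by (auto simp: card_2_iff)
  moreover have "i \<in> N" "p \<in> N" using calculation colE_sub[of j] by auto
  ultimately show False using pair_col_not_all_pair_rows[OF j] r by auto
qed

text \<open>The two columns of a two-cell row have \<open>n\<close> cells of \<open>E\<close>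
  together and all other columns have two. So \<open>b\<close> is one of the pair, and its partner
  has at least two cells, exactly two if \<open>b\<close> has \<open>n - 2\<close>.\<close>

lemma large_col:
  assumes "b \<in> N" "card (colE b) > 2"
  shows "i \<in> N \<Longrightarrow> card (rowE i) = 2 \<Longrightarrow> (i, b) \<in> E"
    and "card (colE b) + 2 \<le> card N"
    and "card {i \<in> N. card (rowE i) = 2} \<le> card (colE b)"
    and "card N \<le> card {j \<in> N. card (colE j) = 2} + 2"
    and "card (colE b) + 2 = card N \<Longrightarrow> j \<in> N \<Longrightarrow> j \<noteq> b \<Longrightarrow> card (colE j) = 2"
proof -
  show inE: "(i, b) \<in> E" if i: "i \<in> N" "card (rowE i) = 2" for i
  proof -
    obtain j0 j1 where R: "rowE i = {j0, j1}" "j0 \<noteq> j1" using i by (auto simp: card_2_iff)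
    then have "b = j0 \<or> b = j1" using pair_row(3)[OF i(1) R, of b] assms by fastforce
    then show ?thesis using R by auto
  qed
  then show "card {i \<in> N. card (rowE i) = 2} \<le> card (colE b)"
    by (intro card_mono finite_colE) auto
  obtain i where i: "i \<in> N" "card (rowE i) = 2" using ex_pair_row row2 card_E by auto
  then have "b \<in> rowE i" using inE by auto
  then obtain j1 where R: "rowE i = {b, j1}" "b \<noteq> j1"
    using card_2_obtain[OF i(2)] by metis
  have j1: "j1 \<in> N" using R rowE_sub[of i] by auto
  note P = pair_row[OF i(1) R]
  show "card (colE b) + 2 \<le> card N" using P(1) col2[OF j1] by simp
  have "card (N - {b, j1}) \<le> card {j \<in> N. card (colE j) = 2}"
    using P(3) fin by (intro card_mono) auto
  then show "card N \<le> card {j \<in> N. card (colE j) = 2} + 2"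
    using R j1 assms fin by (simp add: card_Diff_subset)
  show "card (colE j) = 2" if "card (colE b) + 2 = card N" "j \<in> N" "j \<noteq> b"
    using P(1,3) that by (cases "j = j1") auto
qed

lemma contradiction: False
proof -
  interpret T: extremal_trade_cover N "\<lambda>i j. g j i" "E\<inverse>" by (rule transpose_extremal)
  obtain b where b: "b \<in> N" "card (colE b) > 2" using ex_large_col by auto
  obtain a where a: "a \<in> N" "card (rowE a) > 2" using T.ex_large_col by auto
  note B = large_col[OF b]
  have a': "card ((E\<inverse>)\<inverse> `` {a}) > 2" using a by simp
  note A = T.large_col[OF a(1) a', simplified]
  \<comment> \<open>At least \<open>n - 2\<close> columns have two cells, and all of these meet row
    \<open>a\<close> in \<open>E\<close>; the row has at most \<open>n - 2\<close> such
    cells.\<close>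
  have "card (rowE a) + 2 = card N" using A(2,3) B(4) by simp
  then have "card (rowE i) = 2" if "i \<in> N" "i \<noteq> a" for i using A(5)[of i] that by simp
  then have "card (N - {a}) \<le> card {i \<in> N. card (rowE i) = 2}"
    using fin by (intro card_mono) auto
  then show False using B(2,3) a(1) by (simp add: card_Diff_singleton)
qed

end

section \<open>The bound and its transfer to critical sets\<close>

lemma (in trade_cover) card_E_ge: "card E + 3 \<ge> 3 * card N"
proof (rule ccontr)
  assume small: "\<not> ?thesis"
  interpret T: trade_cover N "\<lambda>i j. g j i" "E\<inverse>" by (rule transpose)
  have r: "card (rowE i) \<ge> 2" if "i \<in> N" for i
    using row_nonempty[OF that] card_E_ge_if_singleton_row[OF that] small by linarith
  have c: "card (colE j) \<ge> 2" if "j \<in> N" for j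
    using T.row_nonempty[OF that] T.card_E_ge_if_singleton_row[OF that] small
    by (cases "card (colE j) = 1") auto
  have "\<exists>i\<in>N. card (rowE i) = 2" using ex_pair_row r small by simp
  then obtain i j0 j1 where "i \<in> N" "rowE i = {j0, j1}" "j0 \<noteq> j1"
    by (auto simp: card_2_iff)
  then have "card E + 4 \<ge> 3 * card N" using card_E_ge_if_pair_row(1) c by blast
  then have "card E + 4 = 3 * card N" using small by simp
  then interpret extremal_trade_cover N g E
    by unfold_locales (use r c in auto)
  show False by (rule contradiction)
qed

text \<open>\<open>E\<close> consists of the cells not filled by \<open>C\<close>; a second
  completion after omitting an entry supplies the trade at its cell.\<close>

lemma critical_set_trade_cover:
  assumes "finite N" "N \<noteq> {}" and crit: "critical_set N L C"
  obtains g E where "trade_cover N g E" "card C + card E = (card N)\<^sup>2"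
proof -
  have "C \<subseteq> L" and L: "latin_square N L" and uc: "uniquely_completable N C"
    and omit: "\<And>t. t \<in> C \<Longrightarrow> \<exists>L1 L2. L1 \<noteq> L2 \<and> latin_square N L1 \<and> C - {t} \<subseteq> L1 \<and>
        latin_square N L2 \<and> C - {t} \<subseteq> L2"
    using crit unfolding critical_set_def completes_to_def by blast+
  have uniq: "L' = L" if "latin_square N L'" "C \<subseteq> L'" for L'
    using uc L \<open>C \<subseteq> L\<close> that unfolding uniquely_completable_def by blast
  obtain g where g: "latin_fun N g" "L = {(i, j, g i j) | i j. i \<in> N \<and> j \<in> N}"
    using latin_square_obtain_fun[OF assms(1) L] .
  define F where "F = {(i, j). (i, j, g i j) \<in> C}"
  have C_eq: "C = (\<lambda>(i, j). (i, j, g i j)) ` F" using \<open>C \<subseteq> L\<close> g(2) by (auto simp: F_def)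
  have F_sub: "F \<subseteq> N \<times> N" using \<open>C \<subseteq> L\<close> g(2) by (auto simp: F_def)
  have "card C = card F" unfolding C_eq by (rule card_image) (auto simp: inj_on_def)
  moreover have "card F + card (N \<times> N - F) = card (N \<times> N)"
    using F_sub assms(1)
    by (metis card_Diff_subset card_mono finite_SigmaI finite_subset le_add_diff_inverse)
  ultimately have "card C + card (N \<times> N - F) = (card N)\<^sup>2"
    by (simp add: card_cartesian_product power2_eq_square)
  moreover have "trade_cover N g (N \<times> N - F)"
  proof
    fix i j assume ij: "i \<in> N" "j \<in> N" "(i, j) \<notin> N \<times> N - F"
    then have t: "(i, j, g i j) \<in> C" by (auto simp: F_def)
    then obtain L' where L': "latin_square N L'" "C - {(i, j, g i j)} \<subseteq> L'" "L' \<noteq> L"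
      using omit[OF t] by metis
    obtain h where h: "latin_fun N h" "L' = {(i, j, h i j) | i j. i \<in> N \<and> j \<in> N}"
      using latin_square_obtain_fun[OF assms(1) L'(1)] .
    \<comment> \<open>Containing the omitted entry would make \<open>L'\<close> a completion of
      \<open>C\<close>, hence equal to \<open>L\<close>.\<close>
    have "(i, j, g i j) \<notin> L'" using uniq[OF L'(1)] L' by blast
    then have "h i j \<noteq> g i j" using h ij by auto
    moreover have "h p q = g p q" if "(p, q) \<in> F" "(p, q) \<noteq> (i, j)" for p q
    proof -
      have "(p, q, g p q) \<in> L'" using that L'(2) by (auto simp: F_def)
      then show ?thesis using h by auto
    qed
    ultimately show "\<exists>h. latin_fun N h \<and> h i j \<noteq> g i j \<and> (\<forall>p\<in>N. \<forall>q\<in>N.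
        (p, q) \<notin> N \<times> N - F \<longrightarrow> (p, q) \<noteq> (i, j) \<longrightarrow> h p q = g p q)"
      using h(1) by (intro exI[of _ h]) auto
  qed (use assms g in auto)
  ultimately show thesis using that by blast
qed

theorem theorem1:
  fixes N :: "'a set" and n :: nat and C L :: "('a \<times> 'a \<times> 'a) set"
  assumes "finite N" and "card N = n" and "n \<ge> 1"
    and "completes_to N C L"
    and "int (card C) > (int n)\<^sup>2 - 3 * int n + 3"
  shows "\<not> critical_set N L C"
proof
  assume "critical_set N L C"
  moreover have "N \<noteq> {}" using assms(2,3) by auto
  ultimately obtain g E where "trade_cover N g E" and card: "card C + card E = (card N)\<^sup>2"
    using critical_set_trade_cover[OF assms(1)] by metis
  then have "card E + 3 \<ge> 3 * n" using trade_cover.card_E_ge assms(2) by blast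
  moreover have "int (card C) + int (card E) = (int n)\<^sup>2"
    using card assms(2) by (metis of_nat_add of_nat_power)
  ultimately show False using assms(5) by linarith
qed

end
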